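(* Let $n\ge 2$ be an integer and $\delta>0$. Let $G$ be a bipartite graph on $2n$ vertices of maximum degree $d$ which is a $\delta$-expander, and let $e$ be an edge of $G$. Assume that $G$ admits a perfect matching. Then \[p(e)\ge \frac1d\, n^{-2\ln(d-1)/\ln(1+\delta)}.\]
   Context: A bipartite graph $G=(U,V,E)$ with vertex classes $U,V$ is a $\delta$-expander if $|N(U')|\ge(1+\delta)|U'|$ for every $U'\subseteq U$ with $|U'|\le |U|/2$, and $|N(V')|\ge (1+\delta)|V'|$ for every $V'\subseteq V$ with $|V'|\le |V|/2$, where $N(\cdot)$ denotes the set of neighbours. For a graph admitting a perfect matching and an edge $e$, $p(e)$ is the probability that $e$ belongs to a uniformly random perfect matching of the graph. *)

theory Defs
  imports "HOL-Probability.Probability"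
begin

text \<open>
  Graphs are finite and simple; an edge is the unordered pair of its end points, and the
  vertex classes are part of the data of a bipartite graph.
\<close>

definition bipartite_graph :: "'a set \<Rightarrow> 'a set \<Rightarrow> 'a set set \<Rightarrow> bool" where
  "bipartite_graph U V E \<longleftrightarrow>
     finite U \<and> finite V \<and> U \<inter> V = {} \<and> (\<forall>e\<in>E. \<exists>u\<in>U. \<exists>v\<in>V. e = {u, v})"

definition neighbours :: "'a set set \<Rightarrow> 'a set \<Rightarrow> 'a set" where
  "neighbours E S = {w. \<exists>s\<in>S. {s, w} \<in> E}"

definition expander :: "real \<Rightarrow> 'a set \<Rightarrow> 'a set \<Rightarrow> 'a set set \<Rightarrow> bool" where
  "expander \<delta> U V E \<longleftrightarrow>
     (\<forall>U'\<subseteq>U. real (card U') \<le> real (card U) / 2 \<longrightarrow>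
        real (card (neighbours E U')) \<ge> (1 + \<delta>) * real (card U')) \<and>
     (\<forall>V'\<subseteq>V. real (card V') \<le> real (card V) / 2 \<longrightarrow>
        real (card (neighbours E V')) \<ge> (1 + \<delta>) * real (card V'))"

definition degree :: "'a set set \<Rightarrow> 'a \<Rightarrow> nat" where
  "degree E v = card {e \<in> E. v \<in> e}"

definition max_degree :: "'a set \<Rightarrow> 'a set set \<Rightarrow> nat" where
  "max_degree W E = Max (degree E ` W)"

definition perfect_matching :: "'a set \<Rightarrow> 'a set set \<Rightarrow> 'a set set \<Rightarrow> bool" where
  "perfect_matching W E M \<longleftrightarrow> M \<subseteq> E \<and> (\<forall>w\<in>W. \<exists>!e. e \<in> M \<and> w \<in> e)"

text \<open>
  As \<open>pmf_of_set\<close> is only meaningful on a finite non-empty set, \<open>edge_prob\<close> is to be used only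
  for finite graphs that admit a perfect matching.
\<close>

definition edge_prob :: "'a set \<Rightarrow> 'a set set \<Rightarrow> 'a set \<Rightarrow> real" where
  "edge_prob W E e = measure_pmf.prob (pmf_of_set {M. perfect_matching W E M}) {M. e \<in> M}"

end

theory Submission
  imports Defs "HOL-Combinatorics.Cycles"
begin

text \<open>
  Perfect matchings are read as bijections \<open>f: U \<rightarrow> V\<close>. Fix \<open>e = uv\<close> and let \<open>f\<close> be a matching
  with \<open>f u \<noteq> v\<close>. In the digraph on \<open>U\<close> with an arc from \<open>x\<close> to \<open>y\<close> whenever \<open>x\<close> is adjacent to
  \<open>f y\<close>, both out-balls and in-balls grow by the factor \<open>1 + \<delta>\<close> until they cover more than half of
  \<open>U\<close>. Hence a shortest path from the partner of \<open>v\<close> to \<open>u\<close> has length at most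
  \<open>N = \<lfloor>2 ln n / ln (1 + \<delta>)\<rfloor>\<close>, and switching along it gives a matching \<open>g\<close> with \<open>g u = v\<close>. Given
  \<open>g\<close>, the switched cycle is determined by the first \<open>N\<close> arcs of the walk from \<open>u\<close> around it, and
  each arc has at most \<open>d - 1\<close> candidates because it avoids the edge of \<open>g\<close>. So at most
  \<open>(d - 1)^N\<close> matchings \<open>f\<close> lead to the same \<open>g\<close>, whence \<open>p(e) \<ge> 1 / (1 + (d - 1)^N)\<close>, and
  \<open>1 + (d - 1)^N \<le> d (d - 1)^N\<close>.
\<close>

section \<open>Growth and short paths in expanding digraphs\<close>

text \<open>While the sets reached in exactly \<open>j\<close> steps cover at most half of
  \<open>X\<close>, each further step multiplies their size by at least \<open>c\<close>. Sizes are
  bounded by \<open>card X\<close> and \<open>c > 1\<close>, so half of \<open>X\<close> is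
  eventually exceeded; the first such \<open>k\<close> satisfies both conclusions.\<close>

lemma expansion_ball:
  fixes D :: "('a \<times> 'a) set" and c :: real
  assumes "finite X" "a \<in> X" "D \<subseteq> X \<times> X" "c > 1"
    and exp: "\<And>S. S \<subseteq> X \<Longrightarrow> real (card S) \<le> real (card X) / 2 \<Longrightarrow> real (card (D `` S)) \<ge> c * real (card S)"
  obtains k where "c ^ k \<le> real (card X)" "real (card ((D ^^ k) `` {a})) > real (card X) / 2"
proof -
  define B where "B k = (D ^^ k) `` {a}" for k
  have B_sub: "B k \<subseteq> X" for k
    unfolding B_def using assms(2,3) by (induction k) auto
  have B_Suc: "B (Suc k) = D `` B k" for k
    unfolding B_def by auto
  have B_le: "real (card (B k)) \<le> real (card X)" for k
    using B_sub assms(1) by (simp add: card_mono)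
  have grow: "c ^ k \<le> real (card (B k))" if "\<forall>j<k. real (card (B j)) \<le> real (card X) / 2" for k
    using that
  proof (induction k)
    case 0
    then show ?case by (simp add: B_def)
  next
    case (Suc k)
    then have "c ^ Suc k \<le> c * real (card (B k))"
      using assms(4) by simp
    also have "\<dots> \<le> real (card (B (Suc k)))"
      unfolding B_Suc using exp[OF B_sub] Suc.prems by blast
    finally show ?case .
  qed
  have ex: "\<exists>k. real (card (B k)) > real (card X) / 2"
  proof (rule ccontr)
    assume "\<nexists>k. real (card (B k)) > real (card X) / 2"
    then have "c ^ k \<le> real (card X)" for k
      using grow[of k] B_le[of k] by (force simp: not_less)
    then show False
      using real_arch_pow[OF assms(4)] by (meson not_less)
  qed
  define k where "k = (LEAST k. real (card (B k)) > real (card X) / 2)"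
  have "real (card (B k)) > real (card X) / 2"
    unfolding k_def using ex by (rule LeastI_ex)
  moreover have "\<forall>j<k. real (card (B j)) \<le> real (card X) / 2"
    unfolding k_def using not_less_Least by (metis not_less)
  ultimately show ?thesis
    using that[of k] order_trans[OF grow[of k] B_le[of k]] unfolding B_def by blast
qed

text \<open>Forward from \<open>a\<close> and backward from \<open>b\<close>, more than half of
  \<open>X\<close> is reached, so the two sets meet and the two walks join. The length is bounded
  through \<open>c ^ L\<close>, which keeps logarithms out until the final estimate.\<close>

lemma expansion_short_path:
  fixes D :: "('a \<times> 'a) set" and c :: real
  assumes "finite X" "a \<in> X" "b \<in> X" "D \<subseteq> X \<times> X" "c > 1"
    and out: "\<And>S. S \<subseteq> X \<Longrightarrow> real (card S) \<le> real (card X) / 2 \<Longrightarrow> real (card (D `` S)) \<ge> c * real (card S)"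
    and in': "\<And>S. S \<subseteq> X \<Longrightarrow> real (card S) \<le> real (card X) / 2 \<Longrightarrow> real (card (D\<inverse> `` S)) \<ge> c * real (card S)"
  obtains L where "(a, b) \<in> D ^^ L" "c ^ L \<le> real (card X) ^ 2"
proof -
  obtain k where k: "c ^ k \<le> real (card X)" "real (card ((D ^^ k) `` {a})) > real (card X) / 2"
    using expansion_ball[OF assms(1,2,4,5) out] by blast
  have "D\<inverse> \<subseteq> X \<times> X" using assms(4) by auto
  then obtain l where l: "c ^ l \<le> real (card X)" "real (card ((D\<inverse> ^^ l) `` {b})) > real (card X) / 2"
    using expansion_ball[OF assms(1,3) _ assms(5) in'] by blast
  have sub: "(R ^^ i) `` {x} \<subseteq> X" if "R \<subseteq> X \<times> X" "x \<in> X" for R :: "('a \<times> 'a) set" and i x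
    using that by (induction i) auto
  have "(D ^^ k) `` {a} \<inter> (D\<inverse> ^^ l) `` {b} \<noteq> {}"
  proof
    assume "(D ^^ k) `` {a} \<inter> (D\<inverse> ^^ l) `` {b} = {}"
    then have "card ((D ^^ k) `` {a}) + card ((D\<inverse> ^^ l) `` {b}) = card ((D ^^ k) `` {a} \<union> (D\<inverse> ^^ l) `` {b})"
      using assms(1) sub[OF assms(4,2)] sub[OF \<open>D\<inverse> \<subseteq> X \<times> X\<close> assms(3)]
      by (metis card_Un_disjoint finite_subset)
    also have "\<dots> \<le> card X"
      using assms(1) sub[OF assms(4,2)] sub[OF \<open>D\<inverse> \<subseteq> X \<times> X\<close> assms(3)]
      by (simp add: card_mono)
    finally have "real (card ((D ^^ k) `` {a})) + real (card ((D\<inverse> ^^ l) `` {b})) \<le> real (card X)"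
      by linarith
    then show False using k(2) l(2) by linarith
  qed
  then obtain z where "(a, z) \<in> D ^^ k" "(b, z) \<in> D\<inverse> ^^ l"
    by auto
  moreover have "R\<inverse> ^^ i = (R ^^ i)\<inverse>" for R :: "('a \<times> 'a) set" and i
    by (induction i) (simp_all add: relpow_commute flip: converse_relcomp)
  ultimately have "(a, b) \<in> D ^^ (k + l)"
    by (auto simp: relpow_add)
  moreover have "c ^ (k + l) \<le> real (card X) ^ 2"
    using mult_mono[OF k(1) l(1)] assms(5) by (simp add: power_add power2_eq_square)
  ultimately show ?thesis by (rule that)
qed

text \<open>A shortest walk repeats no vertex, since cutting out the stretch between two visits
  would shorten it. Distinct vertices are needed to close the path into a cycle.\<close>

lemma relpow_shortest_inj:
  assumes "(a, b) \<in> D ^^ m"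
  obtains L p where "L \<le> m" "p 0 = a" "p L = b" "\<forall>i<L. (p i, p (Suc i)) \<in> D" "inj_on p {..L}"
proof -
  define L where "L = (LEAST L. (a, b) \<in> D ^^ L)"
  have L: "(a, b) \<in> D ^^ L" "L \<le> m" and min: "\<And>l. (a, b) \<in> D ^^ l \<Longrightarrow> L \<le> l"
    unfolding L_def using assms by (auto intro: LeastI Least_le)
  obtain p where p: "p 0 = a" "p L = b" "\<forall>i<L. (p i, p (Suc i)) \<in> D"
    using L(1) by (auto simp: relpow_fun_conv)
  have walk: "(p i, p (i + j)) \<in> D ^^ j" if "i + j \<le> L" for i j
    using that p(3) by (induction j) auto
  have "p i \<noteq> p j" if "i < j" "j \<le> L" for i j
  proof
    assume "p i = p j"
    moreover have "(a, p i) \<in> D ^^ i" "(p j, b) \<in> D ^^ (L - j)"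
      using walk[of 0 i] walk[of j "L - j"] that p by auto
    ultimately have "(a, b) \<in> D ^^ (i + (L - j))"
      by (auto simp: relpow_add)
    then show False using min[of "i + (L - j)"] that by linarith
  qed
  then have "inj_on p {..L}"
    by (metis atMost_iff inj_onI linorder_neqE_nat)
  with L p show ?thesis by (intro that)
qed

section \<open>Counting walks, and permutations that are one short cycle\<close>

text \<open>Induction on the first arc, with at most \<open>b\<close> choices each time. Finiteness
  is carried along because \<open>card\<close> is 0 on infinite sets.\<close>

lemma card_walks_le:
  assumes fin: "finite X" and "D \<subseteq> X \<times> X" "\<And>x. x \<in> X \<Longrightarrow> card (D `` {x}) \<le> b" "u \<in> X"
  shows "finite {w :: 'a list. length w = Suc N \<and> w ! 0 = u \<and> (\<forall>i<N. (w ! i, w ! Suc i) \<in> D)}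
    \<and> card {w :: 'a list. length w = Suc N \<and> w ! 0 = u \<and> (\<forall>i<N. (w ! i, w ! Suc i) \<in> D)} \<le> b ^ N"
    (is "finite (?W u N) \<and> _")
  using assms(4)
proof (induction N arbitrary: u)
  case 0
  have "?W u 0 = {[u]}" by (auto simp: length_Suc_conv)
  then show ?case by simp
next
  case (Suc N)
  have Wsub: "?W u (Suc N) \<subseteq> (\<Union>x \<in> D `` {u}. (#) u ` ?W x N)"
  proof
    fix w assume w: "w \<in> ?W u (Suc N)"
    then obtain ws where ws: "w = u # ws" "length ws = Suc N"
      by (cases w) auto
    then have "(u, ws ! 0) \<in> D" "ws \<in> ?W (ws ! 0) N"
      using w by fastforce+
    then show "w \<in> (\<Union>x \<in> D `` {u}. (#) u ` ?W x N)"
      using ws by blast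
  qed
  have sub: "D `` {u} \<subseteq> X" using assms(2) by auto
  then have finD: "finite (D `` {u})" using fin finite_subset by blast
  have IH: "finite (?W x N)" "card (?W x N) \<le> b ^ N" if "x \<in> D `` {u}" for x
    using Suc.IH[of x] that sub by auto
  have finU: "finite (\<Union>x \<in> D `` {u}. (#) u ` ?W x N)"
    using finD IH by blast
  have "card (?W u (Suc N)) \<le> card (\<Union>x \<in> D `` {u}. (#) u ` ?W x N)"
    using finU Wsub by (rule card_mono)
  also have "\<dots> \<le> (\<Sum>x \<in> D `` {u}. card ((#) u ` ?W x N))"
    by (rule card_UN_le[OF finD])
  also have "\<dots> \<le> (\<Sum>x \<in> D `` {u}. b ^ N)"
    using IH by (intro sum_mono) (meson card_image_le order_trans)
  also have "\<dots> \<le> b ^ Suc N"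
    using assms(3)[OF Suc.prems] by simp
  finally show ?case using finite_subset[OF Wsub finU] by blast
qed

text \<open>For a permutation: a single cycle through \<open>u\<close> of length at most
  \<open>N + 1\<close>, all other points being fixed. The identity is included. The wording by
  iterates fits the encoding of a cycle by its walk from \<open>u\<close>.\<close>

definition short_cycle_at :: "'a \<Rightarrow> nat \<Rightarrow> ('a \<Rightarrow> 'a) \<Rightarrow> bool" where
  "short_cycle_at u N \<sigma> \<longleftrightarrow> (\<exists>j\<in>{1..Suc N}. (\<sigma> ^^ j) u = u) \<and>
     (\<forall>x. x \<notin> (\<lambda>i. (\<sigma> ^^ i) u) ` {..N} \<longrightarrow> \<sigma> x = x)"

text \<open>
  When the cycle has the maximal length \<open>N + 1\<close>, the first \<open>N\<close> steps never return to \<open>u\<close>, but the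
  missing last step can only be the one that closes the cycle.
\<close>

lemma short_cycle_at_eqI:
  assumes \<sigma>: "short_cycle_at u N \<sigma>" and \<tau>: "short_cycle_at u N \<tau>"
    and eq: "\<And>i. i \<le> N \<Longrightarrow> (\<sigma> ^^ i) u = (\<tau> ^^ i) u"
  shows "\<sigma> = \<tau>"
proof
  fix x
  have step: "\<sigma> ((\<sigma> ^^ i) u) = \<tau> ((\<sigma> ^^ i) u)" if "i < N" for i
    using eq[of i] eq[of "Suc i"] that by simp
  \<comment> \<open>If a cycle closes within \<open>N\<close> steps, its \<open>N\<close>-th iterate
    already occurred at index \<open>N - j < N\<close>, where \<open>step\<close> applies.\<close>
  have split: "(\<rho> ^^ N) u = (\<rho> ^^ (N - j)) u" if "(\<rho> ^^ j) u = u" "j \<le> N" for \<rho> :: "'a \<Rightarrow> 'a" and j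
  proof -
    have "(\<rho> ^^ N) u = (\<rho> ^^ (N - j + j)) u" using that by simp
    also have "\<dots> = (\<rho> ^^ (N - j)) u" using that by (simp only: funpow_add o_apply)
    finally show ?thesis .
  qed
  obtain j where j: "1 \<le> j" "j \<le> Suc N" "(\<sigma> ^^ j) u = u"
    using \<sigma> by (auto simp: short_cycle_at_def)
  obtain l where l: "1 \<le> l" "l \<le> Suc N" "(\<tau> ^^ l) u = u"
    using \<tau> by (auto simp: short_cycle_at_def)
  have last: "\<sigma> ((\<sigma> ^^ N) u) = \<tau> ((\<sigma> ^^ N) u)"
  proof (cases "j = Suc N \<and> l = Suc N")
    case True
    then show ?thesis using j(3) l(3) eq[of N] by simp
  next
    case False
    then consider "j \<le> N" | "l \<le> N" using j l by linarith
    then show ?thesis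
    proof cases
      case 1
      then show ?thesis using split[OF j(3)] step[of "N - j"] j(1) by simp
    next
      case 2
      then have "(\<sigma> ^^ N) u = (\<sigma> ^^ (N - l)) u"
        using split[OF l(3)] eq[of N] eq[of "N - l"] by simp
      then show ?thesis using 2 step[of "N - l"] l(1) by simp
    qed
  qed
  show "\<sigma> x = \<tau> x"
  proof (cases "x \<in> (\<lambda>i. (\<sigma> ^^ i) u) ` {..N}")
    case True
    then obtain i where "i \<le> N" "x = (\<sigma> ^^ i) u" by auto
    then show ?thesis using step last by (cases "i = N") auto
  next
    case False
    moreover have "(\<lambda>i. (\<sigma> ^^ i) u) ` {..N} = (\<lambda>i. (\<tau> ^^ i) u) ` {..N}"
      using eq by (intro image_cong) auto
    ultimately show ?thesis using \<sigma> \<tau> by (auto simp: short_cycle_at_def)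
  qed
qed

text \<open>Applying the cycle \<open>i\<close> times to every entry rotates the list by
  \<open>i\<close>, and the head of the rotated list is the required entry.\<close>

lemma cycle_of_list_funpow_hd:
  assumes "distinct cs" "cs \<noteq> []"
  shows "(cycle_of_list cs ^^ i) (cs ! 0) = cs ! (i mod length cs)"
proof -
  have "(cycle_of_list cs ^^ i) (cs ! 0) = map (cycle_of_list cs ^^ i) cs ! 0"
    using assms by simp
  also have "\<dots> = rotate i cs ! 0"
    using cyclic_rotation[of cs i] assms by simp
  also have "\<dots> = cs ! (i mod length cs)"
    using assms by (simp add: nth_rotate)
  finally show ?thesis .
qed

text \<open>Connects the explicit cycle built by switching with the orbit condition used for
  counting.\<close>

lemma short_cycle_at_cycle_of_list:
  assumes "distinct cs" "cs \<noteq> []" "length cs \<le> Suc N"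
  shows "short_cycle_at (cs ! 0) N (cycle_of_list cs)"
  unfolding short_cycle_at_def
proof (intro conjI allI impI)
  show "\<exists>j\<in>{1..Suc N}. (cycle_of_list cs ^^ j) (cs ! 0) = cs ! 0"
    using assms cycle_of_list_funpow_hd[OF assms(1,2), of "length cs"]
    by (intro bexI[of _ "length cs"]) (auto simp: Suc_le_eq)
next
  fix x assume x: "x \<notin> (\<lambda>i. (cycle_of_list cs ^^ i) (cs ! 0)) ` {..N}"
  have "x \<notin> set cs"
  proof
    assume "x \<in> set cs"
    then obtain i where "i < length cs" "x = cs ! i" by (auto simp: in_set_conv_nth)
    then have "x = (cycle_of_list cs ^^ i) (cs ! 0)" "i \<le> N"
      using cycle_of_list_funpow_hd[OF assms(1,2), of i] assms(3) by auto
    then show False using x by blast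
  qed
  then show "cycle_of_list cs x = x" by (rule id_outside_supp)
qed

section \<open>Perfect matchings as bijections\<close>

text \<open>Extensional functions fix the values outside \<open>U\<close>, so that each perfect
  matching comes from exactly one map.\<close>

definition matching_maps :: "'a set \<Rightarrow> 'a set \<Rightarrow> 'a set set \<Rightarrow> ('a \<Rightarrow> 'a) set" where
  "matching_maps U V E = {f \<in> U \<rightarrow>\<^sub>E V. bij_betw f U V \<and> (\<forall>x\<in>U. {x, f x} \<in> E)}"

lemma finite_matching_maps:
  assumes "finite U" "finite V"
  shows "finite (matching_maps U V E)"
  using finite_PiE[OF assms(1), of "\<lambda>_. V"] assms(2) unfolding matching_maps_def by simp

lemma mem_graph_image_iff:
  assumes "U \<inter> V = {}" "f \<in> U \<rightarrow>\<^sub>E V" "u \<in> U" "v \<in> V"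
  shows "{u, v} \<in> (\<lambda>x. {x, f x}) ` U \<longleftrightarrow> f u = v"
  using assms by (auto simp: doubleton_eq_iff)

text \<open>For surjectivity, each vertex of \<open>U\<close> is sent to its partner in
  \<open>M\<close>. The unique edge at each vertex of \<open>V\<close> makes this map injective and
  onto \<open>V\<close>.\<close>

lemma bij_betw_matching_maps:
  assumes "bipartite_graph U V E"
  shows "bij_betw (\<lambda>f. (\<lambda>x. {x, f x}) ` U) (matching_maps U V E) {M. perfect_matching (U \<union> V) E M}"
  unfolding bij_betw_def
proof
  have disj: "U \<inter> V = {}" and E: "\<And>e. e \<in> E \<Longrightarrow> \<exists>u\<in>U. \<exists>v\<in>V. e = {u, v}"
    using assms by (auto simp: bipartite_graph_def)
  show "inj_on (\<lambda>f. (\<lambda>x. {x, f x}) ` U) (matching_maps U V E)"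
  proof (rule inj_onI)
    fix f g
    assume f: "f \<in> matching_maps U V E" and g: "g \<in> matching_maps U V E"
      and eq: "(\<lambda>x. {x, f x}) ` U = (\<lambda>x. {x, g x}) ` U"
    have fV: "f \<in> U \<rightarrow>\<^sub>E V" and gV: "g \<in> U \<rightarrow>\<^sub>E V"
      using f g by (auto simp: matching_maps_def)
    show "f = g"
    proof (rule PiE_ext[OF fV gV])
      fix x assume x: "x \<in> U"
      then have "{x, f x} \<in> (\<lambda>x. {x, g x}) ` U" using eq by blast
      moreover have "f x \<in> V" using fV x by auto
      ultimately show "f x = g x"
        using mem_graph_image_iff[OF disj gV x] by simp
    qed
  qed
  show "(\<lambda>f. (\<lambda>x. {x, f x}) ` U) ` matching_maps U V E = {M. perfect_matching (U \<union> V) E M}"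
  proof (intro equalityI subsetI)
    fix M assume "M \<in> (\<lambda>f. (\<lambda>x. {x, f x}) ` U) ` matching_maps U V E"
    then obtain f where f: "f \<in> matching_maps U V E" and M: "M = (\<lambda>x. {x, f x}) ` U"
      by blast
    have bij: "bij_betw f U V" and edge: "\<And>x. x \<in> U \<Longrightarrow> {x, f x} \<in> E"
      using f by (auto simp: matching_maps_def)
    have fV: "\<And>x. x \<in> U \<Longrightarrow> f x \<in> V" using bij by (auto simp: bij_betw_def)
    have "\<exists>!e. e \<in> M \<and> w \<in> e" if "w \<in> U \<union> V" for w
    proof (cases "w \<in> U")
      case True
      then show ?thesis using M fV disj by (intro ex1I[of _ "{w, f w}"]) auto
    next
      case False
      then have "w \<in> f ` U"
        using that bij by (simp add: bij_betw_def)
      then obtain x where x: "x \<in> U" "f x = w" by blast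
      show ?thesis
      proof (intro ex1I[of _ "{x, w}"] conjI)
        show "{x, w} \<in> M" using M x by blast
        fix e assume "e \<in> M \<and> w \<in> e"
        then obtain y where y: "y \<in> U" "e = {y, f y}" "w \<in> {y, f y}" using M by blast
        then have "f y = w" using False by blast
        then show "e = {x, w}"
          using y x bij by (metis bij_betw_imp_inj_on inj_onD)
      qed simp
    qed
    moreover have "M \<subseteq> E" using M edge by auto
    ultimately show "M \<in> {M. perfect_matching (U \<union> V) E M}"
      by (simp add: perfect_matching_def)
  next
    fix M assume "M \<in> {M. perfect_matching (U \<union> V) E M}"
    then have ME: "M \<subseteq> E" and ex1: "\<And>w. w \<in> U \<union> V \<Longrightarrow> \<exists>!e. e \<in> M \<and> w \<in> e"
      by (auto simp: perfect_matching_def)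
    have ex: "\<exists>v. v \<in> V \<and> {x, v} \<in> M" if x: "x \<in> U" for x
    proof -
      obtain e where e: "e \<in> M" "x \<in> e" using ex1[of x] x by blast
      obtain a b where ab: "a \<in> U" "b \<in> V" "e = {a, b}" using E[of e] e ME by blast
      then have "a = x" using e x disj by auto
      then show ?thesis using ab e by blast
    qed
    define f where "f = restrict (\<lambda>x. SOME v. v \<in> V \<and> {x, v} \<in> M) U"
    have f: "f x \<in> V" "{x, f x} \<in> M" if "x \<in> U" for x
      using someI_ex[OF ex[OF that]] that by (auto simp: f_def)
    have "inj_on f U"
    proof (rule inj_onI)
      fix x y assume xy: "x \<in> U" "y \<in> U" "f x = f y"
      have "{x, f x} = {y, f x}"
        using ex1[of "f x"] f[OF xy(1)] f[OF xy(2)] xy(3) by auto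
      then show "x = y" by (auto simp: doubleton_eq_iff)
    qed
    moreover have "f ` U = V"
    proof (intro equalityI subsetI)
      fix v assume v: "v \<in> V"
      obtain e where e: "e \<in> M" "v \<in> e" using ex1[of v] v by blast
      obtain a b where ab: "a \<in> U" "b \<in> V" "e = {a, b}" using E[of e] e ME by blast
      then have "b = v" using e v disj by auto
      moreover have "e = {a, f a}"
        using ex1[of a] e(1) ab f(2)[OF ab(1)] by auto
      ultimately have "f a = v" using ab v disj by (auto simp: doubleton_eq_iff)
      then show "v \<in> f ` U" using ab by blast
    qed (use f in auto)
    ultimately have "f \<in> matching_maps U V E"
      using f ME by (auto simp: matching_maps_def bij_betw_def f_def)
    moreover have "M = (\<lambda>x. {x, f x}) ` U"
    proof (intro equalityI subsetI)
      fix e assume e: "e \<in> M"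
      obtain a b where ab: "a \<in> U" "b \<in> V" "e = {a, b}" using E[of e] e ME by blast
      have "e = {a, f a}" using ex1[of a] e ab f(2)[OF ab(1)] by auto
      then show "e \<in> (\<lambda>x. {x, f x}) ` U" using ab by blast
    qed (use f in auto)
    ultimately show "M \<in> (\<lambda>f. (\<lambda>x. {x, f x}) ` U) ` matching_maps U V E"
      by blast
  qed
qed

lemma image_Int_Collect_eq: "h ` A \<inter> B = h ` {a \<in> A. h a \<in> B}"
  by blast

text \<open>The bijection turns the uniform probability into a ratio of cardinalities; the set of
  matchings is finite and non-empty, as \<open>pmf_of_set\<close> requires.\<close>

lemma edge_prob_matching_maps:
  assumes "bipartite_graph U V E" "\<exists>M. perfect_matching (U \<union> V) E M" "u \<in> U" "v \<in> V"
  shows "edge_prob (U \<union> V) E {u, v} =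
    real (card {f \<in> matching_maps U V E. f u = v}) / real (card (matching_maps U V E))"
proof -
  let ?F = "matching_maps U V E" and ?P = "{M. perfect_matching (U \<union> V) E M}"
  let ?h = "\<lambda>f. (\<lambda>x. {x, f x}) ` U"
  have bij: "bij_betw ?h ?F ?P" by (rule bij_betw_matching_maps[OF assms(1)])
  have "finite ?F" using assms(1) by (intro finite_matching_maps) (auto simp: bipartite_graph_def)
  then have "finite ?P" using bij bij_betw_finite by blast
  moreover have "?P \<noteq> {}" using assms(2) by blast
  ultimately have "edge_prob (U \<union> V) E {u, v} = real (card (?P \<inter> {M. {u, v} \<in> M})) / real (card ?P)"
    unfolding edge_prob_def by (simp add: measure_pmf_of_set)
  moreover have "card ?P = card ?F" using bij_betw_same_card[OF bij] by simp
  moreover have "card (?P \<inter> {M. {u, v} \<in> M}) = card {f \<in> ?F. f u = v}"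
  proof -
    have "?P \<inter> {M. {u, v} \<in> M} = ?h ` ?F \<inter> {M. {u, v} \<in> M}"
      using bij_betw_imp_surj_on[OF bij] by simp
    also have "\<dots> = ?h ` {f \<in> ?F. ?h f \<in> {M. {u, v} \<in> M}}"
      by (rule image_Int_Collect_eq)
    also have "\<dots> = ?h ` {f \<in> ?F. {u, v} \<in> ?h f}" by simp
    also have "{f \<in> ?F. {u, v} \<in> ?h f} = {f \<in> ?F. f u = v}"
    proof (rule Collect_cong, rule conj_cong[OF refl])
      fix f assume "f \<in> ?F"
      then have "f \<in> U \<rightarrow>\<^sub>E V" by (simp add: matching_maps_def)
      then show "({u, v} \<in> ?h f) = (f u = v)"
        using assms(1,3,4) by (intro mem_graph_image_iff) (auto simp: bipartite_graph_def)
    qed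
    finally show ?thesis
      using bij_betw_imp_inj_on[OF bij] by (simp add: card_image inj_on_subset)
  qed
  ultimately show ?thesis by simp
qed

section \<open>Degrees and the number of switches leading to one matching\<close>

lemma degree_le_max_degree:
  assumes "finite W" "w \<in> W"
  shows "degree E w \<le> max_degree W E"
  using assms by (simp add: max_degree_def)

lemma card_neighbours_le_degree:
  assumes "finite E"
  shows "card (neighbours E {x}) \<le> degree E x"
proof -
  have "card (neighbours E {x}) = card ((\<lambda>w. {x, w}) ` neighbours E {x})"
    by (rule card_image[symmetric]) (auto simp: inj_on_def doubleton_eq_iff)
  also have "\<dots> \<le> degree E x"
    unfolding degree_def using assms by (intro card_mono) (auto simp: neighbours_def)
  finally show ?thesis .
qed

text \<open>The map from \<open>y\<close> to \<open>{x, f y}\<close> injects the set into the edges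
  at \<open>x\<close> other than the matching edge \<open>{x, f x}\<close>. This saves one over the
  degree.\<close>

lemma card_neighbours_matched_le:
  assumes "finite E" "inj_on f U" "x \<in> U" "{x, f x} \<in> E"
  shows "card {y \<in> U. {x, f y} \<in> E \<and> y \<noteq> x} \<le> degree E x - 1"
proof -
  let ?S = "{y \<in> U. {x, f y} \<in> E \<and> y \<noteq> x}"
  have "card ?S = card ((\<lambda>y. {x, f y}) ` ?S)"
    by (rule card_image[symmetric]) (use assms(2) in \<open>auto simp: inj_on_def doubleton_eq_iff\<close>)
  also have "\<dots> \<le> card ({e \<in> E. x \<in> e} - {{x, f x}})"
    using assms by (intro card_mono) (auto simp: inj_on_def doubleton_eq_iff)
  also have "\<dots> = degree E x - 1"
    using assms by (subst card_Diff_singleton) (auto simp: degree_def)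
  finally show ?thesis .
qed

lemma finite_bipartite_edges:
  assumes "bipartite_graph U V E"
  shows "finite E"
proof (rule finite_subset)
  show "E \<subseteq> Pow (U \<union> V)" using assms by (fastforce simp: bipartite_graph_def)
qed (use assms in \<open>auto simp: bipartite_graph_def\<close>)

text \<open>\<open>P\<close> holds the candidates \<open>\<sigma>\<close> for which the map
  \<open>g\<close> after \<open>\<sigma>\<close> is a matching avoiding the edge from
  \<open>u\<close> to \<open>g u\<close>. Each is determined by the first \<open>N\<close> steps of
  its walk from \<open>u\<close>, a walk in the digraph \<open>D\<close> of out-degree at most
  \<open>b\<close>.\<close>

lemma card_short_cycle_perms_le:
  fixes b N :: nat
  assumes "bipartite_graph U V E" "g \<in> matching_maps U V E" "u \<in> U"
    and deg: "\<And>x. x \<in> U \<Longrightarrow> degree E x \<le> Suc b"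
  defines "P \<equiv> {\<sigma>. \<sigma> permutes U \<and> short_cycle_at u N \<sigma> \<and> \<sigma> u \<noteq> u \<and> (\<forall>x\<in>U. {x, g (\<sigma> x)} \<in> E)}"
  shows "finite P \<and> card P \<le> b ^ N"
proof -
  define D where "D = {(x, y). x \<in> U \<and> y \<in> U \<and> {x, g y} \<in> E \<and> y \<noteq> x}"
  define W where "W = {w. length w = Suc N \<and> w ! 0 = u \<and> (\<forall>i<N. (w ! i, w ! Suc i) \<in> D)}"
  have finU: "finite U" using assms(1) by (simp add: bipartite_graph_def)
  have inj: "inj_on g U" and edge: "\<And>x. x \<in> U \<Longrightarrow> {x, g x} \<in> E"
    using assms(2) by (auto simp: matching_maps_def bij_betw_def)
  have "card (D `` {x}) \<le> b" if x: "x \<in> U" for x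
  proof -
    have "D `` {x} = {y \<in> U. {x, g y} \<in> E \<and> y \<noteq> x}" using x by (auto simp: D_def)
    then show ?thesis
      using card_neighbours_matched_le[OF finite_bipartite_edges[OF assms(1)] inj x edge[OF x]]
        deg[OF x] by simp
  qed
  moreover have "D \<subseteq> U \<times> U" by (auto simp: D_def)
  ultimately have W: "finite W" "card W \<le> b ^ N"
    unfolding W_def using card_walks_le[OF finU _ _ assms(3)] by blast+
  let ?w = "\<lambda>\<sigma>. map (\<lambda>i. (\<sigma> ^^ i) u) [0..<Suc N]"
  have "inj_on ?w P"
  proof (rule inj_onI)
    fix \<sigma> \<tau> assume "\<sigma> \<in> P" "\<tau> \<in> P" and eq: "?w \<sigma> = ?w \<tau>"
    moreover have "(\<sigma> ^^ i) u = (\<tau> ^^ i) u" if "i \<le> N" for i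
      using arg_cong[OF eq, of "\<lambda>w. w ! i"] that by (simp del: upt_Suc)
    ultimately show "\<sigma> = \<tau>"
      unfolding P_def by (auto intro: short_cycle_at_eqI)
  qed
  moreover have "?w ` P \<subseteq> W"
  proof
    fix w assume "w \<in> ?w ` P"
    then obtain \<sigma> where \<sigma>: "\<sigma> permutes U" "\<sigma> u \<noteq> u" "\<forall>x\<in>U. {x, g (\<sigma> x)} \<in> E"
      and w: "w = ?w \<sigma>" by (auto simp: P_def)
    have U: "(\<sigma> ^^ i) u \<in> U" for i
      using assms(3) \<sigma>(1) by (induction i) (auto simp: permutes_in_image)
    \<comment> \<open>Since \<open>\<sigma>\<close> is injective and moves \<open>u\<close>, it
      moves every iterate, so no step of the walk is a loop, which \<open>D\<close>
      excludes.\<close>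
    have "\<sigma> ((\<sigma> ^^ i) u) \<noteq> (\<sigma> ^^ i) u" for i
      using \<sigma>(2) permutes_inj[OF \<sigma>(1)] by (induction i) (auto simp: inj_def)
    then have "((\<sigma> ^^ i) u, (\<sigma> ^^ Suc i) u) \<in> D" for i
      using U[of i] U[of "Suc i"] \<sigma>(3) by (auto simp: D_def)
    then show "w \<in> W" unfolding W_def w by (simp add: nth_append del: upt_Suc)
  qed
  ultimately show ?thesis
    using W by (metis card_inj_on_le finite_subset inj_on_finite order_trans)
qed

section \<open>Switching along a short cycle\<close>

text \<open>Along a path from the partner of \<open>v\<close> to \<open>u\<close>, every vertex
  before the last takes over the partner of its successor; \<open>u\<close> takes over
  \<open>v\<close>, so the edge \<open>{u, v}\<close> closes the alternating cycle.\<close>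

lemma exists_matching_map_through_edge:
  fixes \<delta> :: real
  assumes bip: "bipartite_graph U V E" and exp: "expander \<delta> U V E" and "\<delta> > 0"
    and f: "f \<in> matching_maps U V E" and u: "u \<in> U" and v: "v \<in> V" and e: "{u, v} \<in> E" and fu: "f u \<noteq> v"
    and N: "\<And>L. (1 + \<delta>) ^ L \<le> real (card U) ^ 2 \<Longrightarrow> L \<le> N"
  obtains g \<sigma> where "g \<in> matching_maps U V E" "g u = v" "\<sigma> permutes U" "short_cycle_at u N \<sigma>"
    "\<And>x. x \<in> U \<Longrightarrow> f x = g (\<sigma> x)"
proof -
  have finU: "finite U" and disj: "U \<inter> V = {}" and E: "\<And>e. e \<in> E \<Longrightarrow> \<exists>u\<in>U. \<exists>v\<in>V. e = {u, v}"
    using bip by (auto simp: bipartite_graph_def)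
  have bij: "bij_betw f U V" and fE: "\<And>x. x \<in> U \<Longrightarrow> {x, f x} \<in> E"
    using f by (auto simp: matching_maps_def)
  have inj: "inj_on f U" and im: "f ` U = V" using bij by (auto simp: bij_betw_def)
  have cardV: "card V = card U" using bij_betw_same_card[OF bij] by simp
  have nbU: "neighbours E S \<subseteq> V" if "S \<subseteq> U" for S
    using that E disj by (fastforce simp: neighbours_def doubleton_eq_iff)
  have nbV: "neighbours E S \<subseteq> U" if "S \<subseteq> V" for S
    using that E disj by (fastforce simp: neighbours_def doubleton_eq_iff)
  \<comment> \<open>Loops are kept here, so that out-neighbourhoods correspond under
    \<open>f\<close> to full neighbourhoods in the graph.\<close>
  define D where "D = {(x, y). x \<in> U \<and> y \<in> U \<and> {x, f y} \<in> E}"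
  have out: "real (card (D `` S)) \<ge> (1 + \<delta>) * real (card S)"
    if S: "S \<subseteq> U" "real (card S) \<le> real (card U) / 2" for S
  proof -
    have "f ` (D `` S) = neighbours E S"
    proof (intro equalityI subsetI)
      fix w assume w: "w \<in> neighbours E S"
      then obtain y where "y \<in> U" "w = f y" using nbU[OF S(1)] im by blast
      then show "w \<in> f ` (D `` S)" using w S(1) by (auto simp: D_def neighbours_def)
    qed (auto simp: D_def neighbours_def)
    moreover have "inj_on f (D `` S)" using inj by (rule inj_on_subset) (auto simp: D_def)
    ultimately have "card (D `` S) = card (neighbours E S)" by (metis card_image)
    then show ?thesis using exp S by (simp add: expander_def)
  qed
  have inw: "real (card (D\<inverse> `` S)) \<ge> (1 + \<delta>) * real (card S)"
    if S: "S \<subseteq> U" "real (card S) \<le> real (card U) / 2" for S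
  proof -
    have fS: "f ` S \<subseteq> V" "card (f ` S) = card S"
      using S(1) im card_image inj_on_subset[OF inj S(1)] by blast+
    have "D\<inverse> `` S = neighbours E (f ` S)"
    proof (intro equalityI subsetI)
      fix w assume w: "w \<in> neighbours E (f ` S)"
      then show "w \<in> D\<inverse> `` S"
        using nbV[OF fS(1)] S(1) by (auto simp: D_def neighbours_def insert_commute)
    qed (auto simp: D_def neighbours_def insert_commute)
    then show ?thesis using exp fS S(2) cardV unfolding expander_def by metis
  qed
  obtain u' where u': "u' \<in> U" "f u' = v" using im v by blast
  obtain m where m: "(u', u) \<in> D ^^ m" "(1 + \<delta>) ^ m \<le> real (card U) ^ 2"
    by (rule expansion_short_path[OF finU u'(1) u, of D "1 + \<delta>"])
      (use out inw \<open>\<delta> > 0\<close> in \<open>auto simp: D_def\<close>)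
  obtain L p where p: "L \<le> m" "p 0 = u'" "p L = u" "\<forall>i<L. (p i, p (Suc i)) \<in> D" "inj_on p {..L}"
    by (rule relpow_shortest_inj[OF m(1)])
  have pU: "p i \<in> U" if "i \<le> L" for i
  proof (cases "i = L")
    case False
    then have "i < L" using that by simp
    then show ?thesis using p(4) unfolding D_def by blast
  qed (use p u in auto)
  \<comment> \<open>The path is listed backwards: the cycle is then based at \<open>u\<close>, and
    \<open>\<sigma>\<close> sends each path vertex to its predecessor.\<close>
  define cs where "cs = map (\<lambda>i. p (L - i)) [0..<Suc L]"
  define \<sigma> where "\<sigma> = cycle_of_list cs"
  have len: "length cs = Suc L" and nth: "\<And>i. i \<le> L \<Longrightarrow> cs ! i = p (L - i)"
    unfolding cs_def by (simp_all del: upt_Suc)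
  have dist: "distinct cs"
    unfolding cs_def using p(5)
    by (fastforce simp: distinct_map inj_on_def less_Suc_eq_le simp del: upt_Suc)
  have cs0: "cs ! 0 = u" using nth[of 0] p(3) by simp
  have set: "set cs = p ` {..L}"
  proof -
    have "set cs = p ` (\<lambda>i. L - i) ` {..L}"
      unfolding cs_def image_image by (auto simp: less_Suc_eq_le simp del: upt_Suc)
    also have "(\<lambda>i. L - i) ` {..L} = {..L}"
    proof (intro equalityI subsetI)
      fix i assume "i \<in> {..L}"
      then show "i \<in> (\<lambda>i. L - i) ` {..L}" by (intro image_eqI[of _ _ "L - i"]) auto
    qed auto
    finally show ?thesis .
  qed
  have perm: "\<sigma> permutes U"
    unfolding \<sigma>_def using cycle_permutes[of cs] by (rule permutes_subset) (use set pU in auto)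
  have short: "short_cycle_at u N \<sigma>"
    unfolding \<sigma>_def cs0[symmetric]
    by (rule short_cycle_at_cycle_of_list[OF dist]) (use len p(1) N[OF m(2)] in auto)
  have step: "\<sigma> (cs ! i) = cs ! (Suc i mod Suc L)" if "i \<le> L" for i
  proof -
    have ne: "cs \<noteq> []" using len by auto
    have "\<sigma> (cs ! i) = (\<sigma> ^^ Suc i) (cs ! 0)"
      using cycle_of_list_funpow_hd[OF dist ne, of i] that len unfolding \<sigma>_def by simp
    then show ?thesis
      using cycle_of_list_funpow_hd[OF dist ne, of "Suc i"] len unfolding \<sigma>_def by metis
  qed
  have \<sigma>u': "\<sigma> u' = u"
    using step[of L] nth[of L] p(2) cs0 by simp
  have \<sigma>p: "\<sigma> (p (Suc i)) = p i" if "i < L" for i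
    using step[of "L - Suc i"] nth[of "L - Suc i"] nth[of "L - i"] that by (simp add: Suc_diff_Suc)
  \<comment> \<open>This says that \<open>\<sigma> y\<close> may take over the partner of
    \<open>y\<close>: by the edge \<open>{u, v}\<close> at \<open>u'\<close>, by an arc of
    \<open>D\<close> further along the path, by \<open>f\<close> itself off the cycle.\<close>
  have edge: "{\<sigma> y, f y} \<in> E" if y: "y \<in> U" for y
  proof (cases "y \<in> set cs")
    case True
    then obtain i where i: "i \<le> L" "y = p i" using set by auto
    show ?thesis
    proof (cases i)
      case 0
      then show ?thesis using i p(2) \<sigma>u' u' e by simp
    next
      case (Suc j)
      then show ?thesis using i \<sigma>p[of j] p(4) by (auto simp: D_def)
    qed
  next
    case False
    then have "\<sigma> y = y" unfolding \<sigma>_def by (rule id_outside_supp)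
    then show ?thesis using fE[OF y] by simp
  qed
  define g where "g = restrict (f \<circ> inv \<sigma>) U"
  have inv: "inv \<sigma> permutes U" using perm by (rule permutes_inv)
  have g\<sigma>: "f x = g (\<sigma> x)" if "x \<in> U" for x
    using that perm by (simp add: g_def permutes_in_image permutes_inverses)
  have "bij_betw (f \<circ> inv \<sigma>) U V"
    using bij_betw_trans[OF permutes_imp_bij[OF inv] bij] .
  then have gbij: "bij_betw g U V"
    unfolding g_def by (simp add: bij_betw_cong[of U "restrict (f \<circ> inv \<sigma>) U" "f \<circ> inv \<sigma>"])
  moreover have "{x, g x} \<in> E" if x: "x \<in> U" for x
  proof -
    have "inv \<sigma> x \<in> U" "\<sigma> (inv \<sigma> x) = x"
      using x inv perm by (simp_all add: permutes_in_image permutes_inverses)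
    then show ?thesis using edge[of "inv \<sigma> x"] x by (simp add: g_def)
  qed
  ultimately have "g \<in> matching_maps U V E"
    unfolding matching_maps_def by (auto simp: g_def bij_betw_def)
  moreover have "g u = v" using g\<sigma>[OF u'(1)] \<sigma>u' u'(2) by simp
  ultimately show ?thesis using perm short g\<sigma> by (rule that)
qed

text \<open>Switching writes every \<open>f\<close> avoiding the edge as \<open>g\<close> after
  \<open>\<sigma>\<close>, with \<open>g\<close> through the edge and \<open>\<sigma>\<close> in
  \<open>P g\<close>. A union bound over \<open>g\<close> finishes.\<close>

lemma card_avoiding_le:
  fixes \<delta> :: real and b :: nat
  assumes bip: "bipartite_graph U V E" and exp: "expander \<delta> U V E" and \<delta>: "\<delta> > 0"
    and u: "u \<in> U" and v: "v \<in> V" and e: "{u, v} \<in> E"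
    and deg: "\<And>x. x \<in> U \<Longrightarrow> degree E x \<le> Suc b"
    and N: "\<And>L. (1 + \<delta>) ^ L \<le> real (card U) ^ 2 \<Longrightarrow> L \<le> N"
  shows "card {f \<in> matching_maps U V E. f u \<noteq> v} \<le> card {g \<in> matching_maps U V E. g u = v} * b ^ N"
proof -
  let ?A = "{g \<in> matching_maps U V E. g u = v}" and ?B = "{f \<in> matching_maps U V E. f u \<noteq> v}"
  define P where "P g = {\<sigma>. \<sigma> permutes U \<and> short_cycle_at u N \<sigma> \<and> \<sigma> u \<noteq> u \<and> (\<forall>x\<in>U. {x, g (\<sigma> x)} \<in> E)}" for g
  have P: "finite (P g)" "card (P g) \<le> b ^ N" if "g \<in> ?A" for g
    using card_short_cycle_perms_le[OF bip _ u deg, of g N] that unfolding P_def by auto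
  have finA: "finite ?A"
    using bip finite_matching_maps[of U V E] by (simp add: bipartite_graph_def)
  let ?I = "\<lambda>g. (\<lambda>\<sigma>. restrict (g \<circ> \<sigma>) U) ` P g"
  have "?B \<subseteq> (\<Union>g\<in>?A. ?I g)"
  proof
    fix f assume "f \<in> ?B"
    then have f: "f \<in> matching_maps U V E" "f u \<noteq> v" by auto
    obtain g \<sigma> where g: "g \<in> matching_maps U V E" "g u = v" "\<sigma> permutes U" "short_cycle_at u N \<sigma>"
      "\<And>x. x \<in> U \<Longrightarrow> f x = g (\<sigma> x)"
      using exists_matching_map_through_edge[OF bip exp \<delta> f(1) u v e f(2) N] by blast
    have "\<sigma> u \<noteq> u" using g(2,5) u f(2) by metis
    moreover have "\<forall>x\<in>U. {x, g (\<sigma> x)} \<in> E"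
      using f(1) g(5) by (simp add: matching_maps_def)
    moreover have "f = restrict (g \<circ> \<sigma>) U"
      using f(1) g(5) by (auto simp: matching_maps_def PiE_def extensional_def fun_eq_iff)
    ultimately show "f \<in> (\<Union>g\<in>?A. ?I g)"
      using g by (auto simp: P_def)
  qed
  then have "card ?B \<le> card (\<Union>g\<in>?A. ?I g)"
    using finA P(1) by (intro card_mono) auto
  also have "\<dots> \<le> (\<Sum>g\<in>?A. card (?I g))" by (rule card_UN_le[OF finA])
  also have "\<dots> \<le> (\<Sum>g\<in>?A. b ^ N)"
    using P by (intro sum_mono) (meson card_image_le order_trans)
  finally show ?thesis by simp
qed

section \<open>The final estimate\<close>

theorem theorem1p9:
  fixes n d :: nat and \<delta> :: real and U V :: "'a set" and E :: "'a set set" and e :: "'a set"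
  assumes "n \<ge> 2"
    and "\<delta> > 0"
    and "bipartite_graph U V E"
    and "card (U \<union> V) = 2 * n"
    and "max_degree (U \<union> V) E = d"
    and "expander \<delta> U V E"
    and "e \<in> E"
    and "\<exists>M. perfect_matching (U \<union> V) E M"
  shows "edge_prob (U \<union> V) E e
           \<ge> 1 / real d * real n powr (- 2 * ln (real d - 1) / ln (1 + \<delta>))"
proof -
  let ?F = "matching_maps U V E"
  have fin: "finite U" "finite V" and disj: "U \<inter> V = {}"
    using assms(3) by (auto simp: bipartite_graph_def)
  obtain u v where uv: "u \<in> U" "v \<in> V" "e = {u, v}"
    using assms(3,7) by (auto simp: bipartite_graph_def)
  obtain f0 where f0: "f0 \<in> ?F"
    using bij_betw_matching_maps[OF assms(3)] assms(8) by (auto simp: bij_betw_def)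
  then have "card U = card V"
    by (auto simp: matching_maps_def dest: bij_betw_same_card)
  then have cardU: "card U = n"
    using assms(4) card_Un_disjoint[OF fin disj] by simp
  have deg: "degree E x \<le> d" if "x \<in> U" for x
    using degree_le_max_degree[of "U \<union> V" x E] that fin assms(5) by simp
  \<comment> \<open>As \<open>n \<ge> 2\<close>, a singleton is at most half of \<open>U\<close>;
    expansion gives \<open>u\<close> two neighbours, hence \<open>d \<ge> 2\<close> and
    \<open>real d - 1 \<ge> 1\<close>.\<close>
  have "(1 + \<delta>) * real (card {u}) \<le> real (card (neighbours E {u}))"
    using assms(1,6) uv(1) cardU unfolding expander_def by auto
  then have "1 < card (neighbours E {u})" using assms(2) by simp
  then have d: "d \<ge> 2"
    using card_neighbours_le_degree[OF finite_bipartite_edges[OF assms(3)], of u] deg[OF uv(1)] by linarith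
  define t where "t = 2 * ln (real n) / ln (1 + \<delta>)"
  define N where "N = nat \<lfloor>t\<rfloor>"
  have t: "t \<ge> 0" using assms(1,2) by (simp add: t_def)
  have N: "L \<le> N" if "(1 + \<delta>) ^ L \<le> real (card U) ^ 2" for L
  proof -
    have "ln ((1 + \<delta>) ^ L) \<le> ln (real n ^ 2)"
      using that assms(1,2) cardU by (subst ln_le_cancel_iff) auto
    then have "real L * ln (1 + \<delta>) \<le> 2 * ln (real n)"
      using assms(1,2) by (simp add: ln_realpow)
    then have "real L \<le> t"
      using assms(2) by (simp add: t_def field_simps)
    then show ?thesis by (simp add: N_def le_nat_floor)
  qed
  define A where "A = card {f \<in> ?F. f u = v}"
  define B where "B = card {f \<in> ?F. f u \<noteq> v}"
  define q where "q = real n powr (2 * ln (real d - 1) / ln (1 + \<delta>))"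
  have "B \<le> A * (d - 1) ^ N"
    unfolding A_def B_def using card_avoiding_le[OF assms(3,6,2) uv(1,2) _ _ N, of "d - 1"] deg d assms(7) uv(3)
    by fastforce
  then have "real B \<le> real (A * (d - 1) ^ N)" by (rule of_nat_mono)
  then have "real B \<le> real A * (real d - 1) ^ N" using d by (simp add: of_nat_diff)
  also have "(real d - 1) ^ N \<le> (real d - 1) powr t"
  proof -
    have "(real d - 1) ^ N = (real d - 1) powr real N"
      using d by (simp add: powr_realpow)
    also have "\<dots> \<le> (real d - 1) powr t"
      using d t by (intro powr_mono) (auto simp: N_def)
    finally show ?thesis .
  qed
  \<comment> \<open>Both sides are the exponential of
    \<open>2 * ln n * ln (d - 1) / ln (1 + \<delta>)\<close>, so base and exponent trade
    places.\<close>
  also have "(real d - 1) powr t = q"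
    using d assms(1) by (simp add: q_def t_def powr_def field_simps)
  finally have B: "real B \<le> real A * q" by (simp add: mult_left_mono)
  have q: "q \<ge> 1"
    unfolding q_def using assms(1,2) d by (intro ge_one_powr_ge_zero) auto
  have F: "card ?F = A + B"
  proof -
    have "?F = {f \<in> ?F. f u = v} \<union> {f \<in> ?F. f u \<noteq> v}" by blast
    then show ?thesis unfolding A_def B_def
      using card_Un_disjoint[of "{f \<in> ?F. f u = v}" "{f \<in> ?F. f u \<noteq> v}"] finite_matching_maps[OF fin, of E]
      by fastforce
  qed
  have pos: "real (card ?F) > 0"
    using f0 finite_matching_maps[OF fin, of E] by (auto simp: card_gt_0_iff)
  have "real (card ?F) \<le> real A * (1 + q)"
    using B F by (simp add: algebra_simps)
  \<comment> \<open>The factor \<open>1 / d\<close> of the bound arises here: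
    \<open>1 + q \<le> 2 * q \<le> d * q\<close>, from \<open>q \<ge> 1\<close> and
    \<open>d \<ge> 2\<close>.\<close>
  also have "\<dots> \<le> real A * (real d * q)"
  proof (rule mult_left_mono)
    have "2 * q \<le> real d * q" using d q by (intro mult_right_mono) auto
    then show "1 + q \<le> real d * q" using q by linarith
  qed simp
  finally have "1 / (real d * q) \<le> real A / real (card ?F)"
    using pos d q by (simp add: field_simps)
  moreover have "edge_prob (U \<union> V) E e = real A / real (card ?F)"
    unfolding A_def uv(3) by (rule edge_prob_matching_maps[OF assms(3,8) uv(1,2)])
  moreover have "1 / real d * real n powr (- 2 * ln (real d - 1) / ln (1 + \<delta>)) = 1 / (real d * q)"
    by (simp add: q_def powr_minus_divide)
  ultimately show ?thesis by simp
qed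

end
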